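(* Let $F,H$ be real square matrices of the same order and let $\alpha_1,\alpha_2\in\mathbb{R}$. Suppose that $F+\alpha_1H$ and $F+\alpha_2H$ are unstable. If there are real square matrices $P_1=P_1^T$, $P_2=P_2^T$, $G$ and $V$ of the same order as $F$ such that $$\begin{pmatrix}-G-G^T & P_i-V^T+G(F+\alpha_iH)\\ P_i-V+(F+\alpha_iH)^TG^T & V(F+\alpha_iH)+(F+\alpha_iH)^TV^T\end{pmatrix}<0,\qquad i=1,2,$$ then $F+(\lambda\alpha_1+(1-\lambda)\alpha_2)H$ is unstable for all $0\le\lambda\le 1$.
   Context: A square matrix is called stable if all of its eigenvalues have strictly negative real part, and unstable if it is not stable. For a symmetric matrix $M$, $M<0$ means that $M$ is negative definite. *)

theory Defs
  imports Complex_Main "Jordan_Normal_Form.Char_Poly"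
begin

definition stable_mat :: "real mat \<Rightarrow> bool" where
  "stable_mat A \<longleftrightarrow>
     (\<forall>z. eigenvalue (map_mat complex_of_real A) z \<longrightarrow> Re z < 0)"

definition unstable_mat :: "real mat \<Rightarrow> bool" where
  "unstable_mat A \<longleftrightarrow> \<not> stable_mat A"

(* The equation M\<^sup>T = M also forces M to be square. *)
definition negative_definite :: "real mat \<Rightarrow> bool" where
  "negative_definite M \<longleftrightarrow> M\<^sup>T = M \<and>
     (\<forall>x \<in> carrier_vec (dim_row M). x \<noteq> 0\<^sub>v (dim_row M) \<longrightarrow> x \<bullet> (M *\<^sub>v x) < 0)"

end

theory Submission
  imports Defs "HOL-Analysis.Topology_Euclidean_Space"
begin

text \<open>The inequalities are affine in \<open>(P\<^sub>i, \<alpha>\<^sub>i)\<close>, so they persist on the segment joining the two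
  parameters. Evaluating them at \<open>(A u, u)\<close>, with \<open>A\<close> the matrix at the given parameter, removes
  \<open>G\<close> and \<open>V\<close> and leaves the Lyapunov inequality \<open>A\<^sup>T P + P A < 0\<close>, which excludes
  eigenvalues on the imaginary axis. Hence no eigenvalue can cross that axis along the segment,
  and either all or none of its matrices are stable.\<close>

unbundle no inner_syntax
no_notation Finite_Cartesian_Product.vec_nth (infixl "$" 90)

section \<open>Continuity of determinants and estimates for eigenvalues\<close>

lemma smult_mat_mult_vec:
  fixes A :: "'a::comm_ring_1 mat"
  assumes "A \<in> carrier_mat nr nc" "v \<in> carrier_vec nc"
  shows "(k \<cdot>\<^sub>m A) *\<^sub>v v = k \<cdot>\<^sub>v (A *\<^sub>v v)"
  using assms by (intro eq_vecI) auto

lemma continuous_on_det: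
  fixes M :: "'a::topological_space \<Rightarrow> 'b::{real_normed_field} mat"
  assumes "\<And>x. x \<in> S \<Longrightarrow> M x \<in> carrier_mat n n"
    and "\<And>i j. i < n \<Longrightarrow> j < n \<Longrightarrow> continuous_on S (\<lambda>x. M x $$ (i, j))"
  shows "continuous_on S (\<lambda>x. det (M x))"
proof -
  have "continuous_on S (\<lambda>x. \<Sum>p | p permutes {0..<n}. signof p * (\<Prod>i = 0..<n. M x $$ (i, p i)))"
    using assms(2) by (intro continuous_intros) (auto dest: permutes_in_image)
  then show ?thesis
    by (rule continuous_on_eq) (simp add: det_def'[OF assms(1)])
qed

text \<open>At a coordinate \<open>m\<close> where an eigenvector has maximal modulus, row
  \<open>m\<close> of the eigenvalue equation bounds \<open>norm z\<close> by the absolute sum of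
  that row. Summing over all rows gives a bound that does not depend on \<open>m\<close> and varies
  continuously with the entries, so it is uniform over a compact family of matrices.\<close>

lemma eigenvalue_norm_le:
  fixes A :: "complex mat"
  assumes A: "A \<in> carrier_mat n n" and "eigenvalue A z"
  shows "norm z \<le> (\<Sum>i<n. \<Sum>j<n. norm (A $$ (i, j)))"
proof -
  obtain v where v: "v \<in> carrier_vec n" "v \<noteq> 0\<^sub>v n" "A *\<^sub>v v = z \<cdot>\<^sub>v v"
    using assms by (auto simp: eigenvalue_def eigenvector_def)
  then obtain k where k: "k < n" "v $ k \<noteq> 0"
    by fastforce
  obtain m where m: "m < n" "\<And>j. j < n \<Longrightarrow> norm (v $ j) \<le> norm (v $ m)"
  proof -
    have "{..<n} \<noteq> {}"
      using k by auto
    then obtain m where "m \<in> {..<n}" "Max ((\<lambda>j. norm (v $ j)) ` {..<n}) = norm (v $ m)"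
      by (rule obtains_MAX[OF finite_lessThan])
    then show thesis
      using that[of m] Max_ge[of "(\<lambda>j. norm (v $ j)) ` {..<n}"] by simp
  qed
  have pos: "norm (v $ m) > 0"
    using k m(2)[of k] by (smt (verit) zero_less_norm_iff)
  have "z * v $ m = (A *\<^sub>v v) $ m"
    using v m by simp
  also have "\<dots> = (\<Sum>j<n. A $$ (m, j) * v $ j)"
    using A v(1) m by (simp add: scalar_prod_def atLeast0LessThan)
  finally have "norm z * norm (v $ m) = norm (\<Sum>j<n. A $$ (m, j) * v $ j)"
    by (metis norm_mult)
  also have "\<dots> \<le> (\<Sum>j<n. norm (A $$ (m, j)) * norm (v $ m))"
    using m by (intro sum_norm_le) (auto simp: norm_mult intro: mult_left_mono)
  finally have "norm z \<le> (\<Sum>j<n. norm (A $$ (m, j)))"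
    using pos by (simp flip: sum_distrib_right)
  also have "\<dots> \<le> (\<Sum>i<n. \<Sum>j<n. norm (A $$ (i, j)))"
    using m by (intro member_le_sum[of m "{..<n}"]) (auto intro: sum_nonneg)
  finally show ?thesis .
qed

text \<open>Each root \<open>a\<close> contributes a factor with \<open>norm (z - a)\<close> at
  least \<open>Re z - Re a\<close>, hence at least \<open>Re z\<close>, and there are
  \<open>n\<close> factors. For fixed \<open>z\<close> such a non-strict bound survives limits of
  matrices, unlike the strict inequality that defines stability.\<close>

lemma power_Re_le_norm_char_poly:
  fixes A :: "complex mat"
  assumes A: "A \<in> carrier_mat n n"
    and "\<And>a. eigenvalue A a \<Longrightarrow> Re a \<le> 0" and "Re z \<ge> 0"
  shows "Re z ^ n \<le> norm (poly (char_poly A) z)"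
proof -
  obtain as where as: "char_poly A = (\<Prod>a\<leftarrow>as. [:- a, 1:])" "length as = n"
    using char_poly_factorized[OF A] by blast
  have "Re a \<le> 0" if "a \<in> set as" for a
    using that assms(2)[of a] by (auto simp: eigenvalue_root_char_poly[OF A] as poly_prod_list prod_list_zero_iff)
  then have "Re z ^ length as \<le> norm (poly (\<Prod>a\<leftarrow>as. [:- a, 1:]) z)"
  proof (induction as)
    case (Cons a as)
    have "Re z \<le> norm (z - a)"
      using complex_Re_le_cmod[of "z - a"] Cons.prems[of a] by simp
    moreover have "Re z ^ length as \<le> norm (poly (\<Prod>a\<leftarrow>as. [:- a, 1:]) z)"
      using Cons by simp
    moreover have "poly (\<Prod>a\<leftarrow>a # as. [:- a, 1:]) z = (z - a) * poly (\<Prod>a\<leftarrow>as. [:- a, 1:]) z"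
      by (simp add: algebra_simps)
    ultimately show ?case
      using \<open>Re z \<ge> 0\<close> by (simp add: norm_mult mult_mono)
  qed simp
  then show ?thesis
    by (simp add: as)
qed

section \<open>Constancy of stability along a connected family\<close>

text \<open>The stable parameters form a clopen subset of \<open>S\<close>. They are closed because stability is
  equivalent to the bounds \<open>Re z ^ n \<le> \<bar>det (z - A t)\<bar>\<close> for \<open>Re z \<ge> 0\<close>, given that there are no
  imaginary eigenvalues. They are open because eigenvalues stay in a compact set, so that the
  unstable parameters are the projection of a compact set.\<close>

lemma stable_mat_connected:
  fixes A :: "'a::metric_space \<Rightarrow> real mat"
  assumes S: "compact S" "connected S"
    and A: "\<And>t. t \<in> S \<Longrightarrow> A t \<in> carrier_mat n n"
    and cont: "\<And>i j. i < n \<Longrightarrow> j < n \<Longrightarrow> continuous_on S (\<lambda>t. A t $$ (i, j))"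
    and imag: "\<And>t z. t \<in> S \<Longrightarrow> eigenvalue (map_mat complex_of_real (A t)) z \<Longrightarrow> Re z \<noteq> 0"
    and "s \<in> S" "t \<in> S" "stable_mat (A s)"
  shows "stable_mat (A t)"
proof -
  define C where "C t = map_mat complex_of_real (A t)" for t
  define q where "q t z = poly (char_poly (C t)) z" for t z
  have C: "C t \<in> carrier_mat n n" if "t \<in> S" for t
    using A[OF that] by (simp add: C_def)
  have C_index: "C t $$ (i, j) = complex_of_real (A t $$ (i, j))"
    if "t \<in> S" "i < n" "j < n" for t i j
    using A[OF that(1)] that by (simp add: C_def)
  have q: "eigenvalue (C t) z \<longleftrightarrow> q t z = 0" if "t \<in> S" for t z
    using eigenvalue_root_char_poly[OF C[OF that]] by (simp add: q_def)
  have q_cont: "continuous_on (S \<times> UNIV) (\<lambda>x. q (fst x) (snd x))"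
  proof -
    \<comment> \<open>\<open>char_matrix\<close> is the matrix minus the scalar, so its negative has
      the characteristic polynomial as determinant. This form gives continuity in the parameter and
      \<open>z\<close> jointly, which the projection argument below needs.\<close>
    have "continuous_on (S \<times> UNIV) (\<lambda>x. det (- char_matrix (C (fst x)) (snd x)))"
    proof (rule continuous_on_det)
      fix i j assume ij: "i < n" "j < n"
      have "continuous_on (S \<times> UNIV) (\<lambda>x. A (fst x) $$ (i, j))"
        by (rule continuous_on_compose2[OF cont[OF ij]]) (auto intro: continuous_intros)
      then have "continuous_on (S \<times> UNIV)
        (\<lambda>x. - (complex_of_real (A (fst x) $$ (i, j)) - snd x * (if i = j then 1 else 0)))"
        by (intro continuous_intros)
      then show "continuous_on (S \<times> UNIV) (\<lambda>x. (- char_matrix (C (fst x)) (snd x)) $$ (i, j))"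
        by (rule continuous_on_eq) (use ij C A in \<open>fastforce simp: char_matrix_def C_index\<close>)
    qed (use C in auto)
    then show ?thesis
      by (rule continuous_on_eq) (auto simp: q_def char_poly_matrix[OF C])
  qed
  define T where "T = {t \<in> S. stable_mat (A t)}"
  have T_iff: "t \<in> T \<longleftrightarrow> t \<in> S \<and> (\<forall>z. Re z \<ge> 0 \<longrightarrow> Re z ^ n \<le> norm (q t z))" for t
  proof safe
    fix z :: complex assume t: "t \<in> T" "Re z \<ge> 0"
    show "Re z ^ n \<le> norm (q t z)"
      unfolding q_def
    proof (rule power_Re_le_norm_char_poly)
      show "C t \<in> carrier_mat n n"
        using t C by (auto simp: T_def)
      show "Re l \<le> 0" if "eigenvalue (C t) l" for l
        using that t by (force simp: T_def stable_mat_def C_def)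
    qed fact
  next
    assume t: "t \<in> S" "\<forall>z. Re z \<ge> 0 \<longrightarrow> Re z ^ n \<le> norm (q t z)"
    have "Re z < 0" if "eigenvalue (C t) z" for z
    proof (rule ccontr)
      assume "\<not> Re z < 0"
      \<comment> \<open>The absence of imaginary eigenvalues enters here: for \<open>n > 0\<close>
        the bound is trivial at \<open>Re z = 0\<close> and could not exclude an eigenvalue
        there.\<close>
      then have "Re z > 0"
        using imag[OF t(1)] that by (force simp: C_def)
      then have "0 < Re z ^ n"
        by simp
      also have "\<dots> \<le> norm (q t z)"
        using t(2) \<open>Re z > 0\<close> by simp
      finally show False
        using that q[OF t(1)] by simp
    qed
    then show "t \<in> T"
      using t by (auto simp: T_def stable_mat_def C_def)
  qed (auto simp: T_def)
  have "closed S"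
    using S(1) by (rule compact_imp_closed)
  have "closed T"
  proof -
    have "closed {t \<in> S. Re z ^ n \<le> norm (q t z)}" for z
    proof -
      have "continuous_on S (\<lambda>t. q t z)"
        by (rule continuous_on_compose2[OF q_cont, of _ "\<lambda>t. (t, z)", simplified])
          (auto intro: continuous_intros)
      then show ?thesis
        using \<open>closed S\<close> by (intro continuous_on_closed_Collect_le continuous_intros)
    qed
    then have "closed (S \<inter> (\<Inter>z\<in>{z. Re z \<ge> 0}. {t \<in> S. Re z ^ n \<le> norm (q t z)}))"
      using \<open>closed S\<close> by (intro closed_Int closed_INT) auto
    also have "S \<inter> (\<Inter>z\<in>{z. Re z \<ge> 0}. {t \<in> S. Re z ^ n \<le> norm (q t z)}) = T"
      by (auto simp: T_iff)
    finally show ?thesis .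
  qed
  moreover have "closed (S - T)"
  proof -
    have "continuous_on S (\<lambda>t. \<Sum>i<n. \<Sum>j<n. \<bar>A t $$ (i, j)\<bar>)"
      by (intro continuous_intros cont) auto
    then have "bounded ((\<lambda>t. \<Sum>i<n. \<Sum>j<n. \<bar>A t $$ (i, j)\<bar>) ` S)"
      by (intro compact_imp_bounded compact_continuous_image S)
    then obtain B where B: "\<And>t. t \<in> S \<Longrightarrow> (\<Sum>i<n. \<Sum>j<n. \<bar>A t $$ (i, j)\<bar>) \<le> B"
      unfolding bounded_iff by (metis imageI real_norm_def abs_le_D1)
    have bound: "norm z \<le> B" if "t \<in> S" "eigenvalue (C t) z" for t z
      using eigenvalue_norm_le[OF C[OF that(1)] that(2)] B[OF that(1)] by (simp add: C_index[OF that(1)])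
    \<comment> \<open>\<open>K\<close> collects the pairs of a parameter and an eigenvalue in the
      closed right half plane. By \<open>bound\<close>, the restriction to the ball loses no
      eigenvalue, and it makes \<open>K\<close> compact.\<close>
    define K where "K = {x \<in> S \<times> cball 0 B. q (fst x) (snd x) = 0 \<and> Re (snd x) \<ge> 0}"
    have "compact (S \<times> cball (0::complex) B)"
      by (intro compact_Times S compact_cball)
    moreover have "closed K"
    proof -
      have "closed {x \<in> S \<times> cball (0::complex) B. q (fst x) (snd x) = 0}"
        using \<open>closed S\<close> by (intro continuous_closed_preimage_constant closed_Times closed_cball
            continuous_on_subset[OF q_cont]) auto
      moreover have "closed {x :: 'a \<times> complex. 0 \<le> Re (snd x)}"
        by (intro closed_Collect_le continuous_intros)
      ultimately have "closed ({x \<in> S \<times> cball (0::complex) B. q (fst x) (snd x) = 0} \<inter>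
          {x. 0 \<le> Re (snd x)})"
        by (rule closed_Int)
      then show ?thesis
        by (simp add: K_def Collect_conj_eq Int_assoc)
    qed
    ultimately have "compact K"
      using compact_Int_closed[of _ K] by (metis (no_types, lifting) K_def Int_absorb1 mem_Collect_eq subsetI)
    then have "compact (fst ` K)"
      by (intro compact_continuous_image continuous_intros)
    also have "fst ` K = S - T"
    proof (intro equalityI subsetI)
      fix t assume "t \<in> S - T"
      then obtain z where z: "t \<in> S" "eigenvalue (C t) z" "Re z \<ge> 0"
        by (force simp: T_def stable_mat_def C_def)
      then have "(t, z) \<in> K"
        using bound[of t z] q[of t z] by (auto simp: K_def)
      then show "t \<in> fst ` K"
        by force
    qed (auto simp: K_def T_def stable_mat_def q[symmetric] C_def dest!: spec)
    finally show ?thesis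
      by (rule compact_imp_closed)
  qed
  moreover have "S \<subseteq> T \<union> (S - T)" "T \<inter> (S - T) \<inter> S = {}"
    by auto
  ultimately have "T \<inter> S = {} \<or> (S - T) \<inter> S = {}"
    using connected_closedD[OF S(2)] by blast
  then show ?thesis
    using assms(6-) by (auto simp: T_def)
qed

section \<open>The Lyapunov inequality and the imaginary axis\<close>

text \<open>The form in \<open>neg\<close> is half the quadratic form of
  \<open>A\<^sup>T * P + P * A\<close>. If \<open>x + i y\<close> were an eigenvector for the
  eigenvalue \<open>i b\<close> with \<open>b\<close> real, then \<open>A x = - b y\<close> and
  \<open>A y = b x\<close>, so by symmetry of \<open>P\<close> the values of the form at
  \<open>x\<close> and \<open>y\<close> would cancel. Negativity then forces both vectors to
  vanish.\<close>

lemma lyapunov_eigenvalue_not_imaginary: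
  fixes A P :: "real mat"
  assumes A: "A \<in> carrier_mat n n" and P: "P \<in> carrier_mat n n" "P\<^sup>T = P"
    and neg: "\<And>u. u \<in> carrier_vec n \<Longrightarrow> u \<noteq> 0\<^sub>v n \<Longrightarrow> (A *\<^sub>v u) \<bullet> (P *\<^sub>v u) < 0"
    and "eigenvalue (map_mat complex_of_real A) z"
  shows "Re z \<noteq> 0"
proof
  assume "Re z = 0"
  obtain v where v: "v \<in> carrier_vec n" "v \<noteq> 0\<^sub>v n" "map_mat complex_of_real A *\<^sub>v v = z \<cdot>\<^sub>v v"
    using assms by (auto simp: eigenvalue_def eigenvector_def)
  define x y where "x = map_vec Re v" and "y = map_vec Im v"
  have xy: "x \<in> carrier_vec n" "y \<in> carrier_vec n"
    using v by (auto simp: x_def y_def)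
  have eq: "(\<Sum>j<n. complex_of_real (A $$ (i, j)) * v $ j) = z * v $ i" if "i < n" for i
    using arg_cong[OF v(3), of "\<lambda>w. w $ i"] that v(1) A
    by (simp add: scalar_prod_def atLeast0LessThan)
  have Ax: "A *\<^sub>v x = - Im z \<cdot>\<^sub>v y"
  proof (rule eq_vecI)
    fix i assume "i < dim_vec (- Im z \<cdot>\<^sub>v y)"
    then have "i < n" using xy by simp
    then show "(A *\<^sub>v x) $ i = (- Im z \<cdot>\<^sub>v y) $ i"
      using arg_cong[OF eq[of i], of Re] v(1) A \<open>Re z = 0\<close>
      by (simp add: scalar_prod_def atLeast0LessThan x_def y_def)
  qed (use A xy in auto)
  have Ay: "A *\<^sub>v y = Im z \<cdot>\<^sub>v x"
  proof (rule eq_vecI)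
    fix i assume "i < dim_vec (Im z \<cdot>\<^sub>v x)"
    then have "i < n" using xy by simp
    then show "(A *\<^sub>v y) $ i = (Im z \<cdot>\<^sub>v x) $ i"
      using arg_cong[OF eq[of i], of Im] v(1) A \<open>Re z = 0\<close>
      by (simp add: scalar_prod_def atLeast0LessThan x_def y_def)
  qed (use A xy in auto)
  have "y \<bullet> (P *\<^sub>v x) = x \<bullet> (P *\<^sub>v y)"
    using transpose_vec_mult_scalar[OF P(1) xy] P xy
    by (metis comm_scalar_prod mult_mat_vec_carrier)
  then have zero: "(A *\<^sub>v x) \<bullet> (P *\<^sub>v x) + (A *\<^sub>v y) \<bullet> (P *\<^sub>v y) = 0"
    using xy P by (simp add: Ax Ay)
  have le: "(A *\<^sub>v u) \<bullet> (P *\<^sub>v u) \<le> 0" if "u \<in> carrier_vec n" for u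
  proof (cases "u = 0\<^sub>v n")
    case True
    then show ?thesis using A P by (simp add: scalar_prod_def)
  qed (use neg[OF that] in simp)
  have "x = 0\<^sub>v n" "y = 0\<^sub>v n"
    using neg[OF xy(1)] neg[OF xy(2)] le[OF xy(1)] le[OF xy(2)] zero by fastforce+
  then have "v $ i = 0" if "i < n" for i
    using that v(1) xy index_map_vec(1)[of i v Re] index_map_vec(1)[of i v Im]
    by (simp add: x_def y_def complex_eq_iff)
  then have "v = 0\<^sub>v n"
    using v(1) by auto
  then show False
    using v(2) by simp
qed

section \<open>The quadratic form of the block matrix\<close>

text \<open>\<open>G\<close> and \<open>V\<close> act as multipliers for the constraint
  \<open>w = A u\<close>: they enter only through a product with the residual
  \<open>A u - w\<close>. The vector \<open>w\<close> stays arbitrary because it will come from an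
  interpolated matrix while \<open>A\<close> is an endpoint.\<close>

lemma lmi_quadratic_form:
  fixes A G P V :: "real mat"
  assumes car: "A \<in> carrier_mat n n" "G \<in> carrier_mat n n" "V \<in> carrier_mat n n"
      "P \<in> carrier_mat n n" and "P\<^sup>T = P"
    and u: "u \<in> carrier_vec n" and w: "w \<in> carrier_vec n"
  shows "(w @\<^sub>v u) \<bullet> (four_block_mat (- G - G\<^sup>T) (P - V\<^sup>T + G * A)
      (P - V + A\<^sup>T * G\<^sup>T) (V * A + A\<^sup>T * V\<^sup>T) *\<^sub>v (w @\<^sub>v u)) =
    2 * (w \<bullet> (P *\<^sub>v u) + (G\<^sup>T *\<^sub>v w + V\<^sup>T *\<^sub>v u) \<bullet> (A *\<^sub>v u - w))"
proof -
  note vec = mult_mat_vec_carrier[where nr = n and n = n]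
  have tr1: "(M\<^sup>T *\<^sub>v a) \<bullet> b = a \<bullet> (M *\<^sub>v b)" and tr2: "b \<bullet> (M\<^sup>T *\<^sub>v a) = a \<bullet> (M *\<^sub>v b)"
    if "M \<in> carrier_mat n n" "a \<in> carrier_vec n" "b \<in> carrier_vec n" for M :: "real mat" and a b
    using transpose_vec_mult_scalar[of M n n b a] that comm_scalar_prod[of b n "M\<^sup>T *\<^sub>v a"] by auto
  have "(w @\<^sub>v u) \<bullet> (four_block_mat (- G - G\<^sup>T) (P - V\<^sup>T + G * A)
      (P - V + A\<^sup>T * G\<^sup>T) (V * A + A\<^sup>T * V\<^sup>T) *\<^sub>v (w @\<^sub>v u)) =
    w \<bullet> ((- G - G\<^sup>T) *\<^sub>v w + (P - V\<^sup>T + G * A) *\<^sub>v u) +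
    u \<bullet> ((P - V + A\<^sup>T * G\<^sup>T) *\<^sub>v w + (V * A + A\<^sup>T * V\<^sup>T) *\<^sub>v u)"
    using car u w
    by (subst four_block_mat_mult_vec[of _ n n _ n _ n])
      (auto intro!: scalar_prod_append add_carrier_vec vec mult_carrier_mat[of _ n n])
  also have "\<dots> = - (w \<bullet> (G *\<^sub>v w)) - w \<bullet> (G\<^sup>T *\<^sub>v w) + w \<bullet> (P *\<^sub>v u) - w \<bullet> (V\<^sup>T *\<^sub>v u)
      + w \<bullet> (G *\<^sub>v (A *\<^sub>v u)) + u \<bullet> (P *\<^sub>v w) - u \<bullet> (V *\<^sub>v w) + u \<bullet> (A\<^sup>T *\<^sub>v (G\<^sup>T *\<^sub>v w))
      + u \<bullet> (V *\<^sub>v (A *\<^sub>v u)) + u \<bullet> (A\<^sup>T *\<^sub>v (V\<^sup>T *\<^sub>v u))"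
    using car u w
    by (simp add: vec minus_carrier_mat[of _ n n] add_mult_distrib_mat_vec[of _ n n] minus_mult_distrib_mat_vec[of _ n n]
        scalar_prod_add_distrib[of _ n] scalar_prod_minus_distrib[of _ n] assoc_mult_mat_vec[of _ n n _ n])
  also have "\<dots> = 2 * (w \<bullet> (P *\<^sub>v u) + (G\<^sup>T *\<^sub>v w + V\<^sup>T *\<^sub>v u) \<bullet> (A *\<^sub>v u - w))"
    \<comment> \<open>\<open>tr1\<close> and \<open>tr2\<close> move every transpose across the
      scalar product, and the instance for \<open>P\<close> identifies the two mixed terms by
      symmetry.\<close>
    using car u w tr2[of P w u]
    by (simp add: vec tr1 tr2 \<open>P\<^sup>T = P\<close> add_scalar_prod_distrib[of _ n]
        scalar_prod_minus_distrib[of _ n])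
  finally show ?thesis .
qed

section \<open>Interpolation between the two inequalities\<close>

theorem theorem4:
  fixes F H G V :: "real mat" and P :: "nat \<Rightarrow> real mat"
    and \<alpha> :: "nat \<Rightarrow> real" and n :: nat
  assumes "F \<in> carrier_mat n n" and "H \<in> carrier_mat n n"
    and "unstable_mat (F + \<alpha> 1 \<cdot>\<^sub>m H)" and "unstable_mat (F + \<alpha> 2 \<cdot>\<^sub>m H)"
    and "G \<in> carrier_mat n n" and "V \<in> carrier_mat n n"
    and "\<forall>i\<in>{1, 2}. P i \<in> carrier_mat n n \<and> P i = (P i)\<^sup>T"
    and "\<forall>i\<in>{1, 2}. negative_definite
      (four_block_mat
        (- G - G\<^sup>T)
        (P i - V\<^sup>T + G * (F + \<alpha> i \<cdot>\<^sub>m H))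
        (P i - V + (F + \<alpha> i \<cdot>\<^sub>m H)\<^sup>T * G\<^sup>T)
        (V * (F + \<alpha> i \<cdot>\<^sub>m H) + (F + \<alpha> i \<cdot>\<^sub>m H)\<^sup>T * V\<^sup>T))"
  shows "\<forall>\<mu>::real. 0 \<le> \<mu> \<and> \<mu> \<le> 1 \<longrightarrow>
    unstable_mat (F + (\<mu> * \<alpha> 1 + (1 - \<mu>) * \<alpha> 2) \<cdot>\<^sub>m H)"
proof (intro allI impI)
  fix \<mu> :: real assume \<mu>: "0 \<le> \<mu> \<and> \<mu> \<le> 1"
  define A where "A t = F + (t * \<alpha> 1 + (1 - t) * \<alpha> 2) \<cdot>\<^sub>m H" for t
  define R where "R t = t \<cdot>\<^sub>m P 1 + (1 - t) \<cdot>\<^sub>m P 2" for t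
  have A: "A t \<in> carrier_mat n n" for t
    using assms(1,2) by (simp add: A_def)
  have P: "P i \<in> carrier_mat n n" "(P i)\<^sup>T = P i" if "i \<in> {1, 2}" for i
    using assms(7) that by auto
  have R: "R t \<in> carrier_mat n n" for t
    using P by (simp add: R_def)
  have RT: "(R t)\<^sup>T = R t" for t
  proof (rule eq_matI)
    fix i j assume "i < dim_row (R t)" "j < dim_col (R t)"
    then have ij: "i < n" "j < n"
      using R[of t] by auto
    have "P k $$ (i, j) = P k $$ (j, i)" if "k \<in> {1, 2}" for k
      using P[OF that] ij by (metis carrier_matD index_transpose_mat(1))
    then show "(R t)\<^sup>T $$ (i, j) = R t $$ (i, j)"
      using ij P(1)[of 1] P(1)[of 2] by (simp add: R_def)
  qed (use R[of t] in auto)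
  have lyap: "(A t *\<^sub>v u) \<bullet> (R t *\<^sub>v u) < 0"
    if t: "t \<in> {0..1}" and u: "u \<in> carrier_vec n" "u \<noteq> 0\<^sub>v n" for t u
  proof -
    \<comment> \<open>Both endpoint inequalities are tested at the same vector
      \<open>w @\<^sub>v u\<close>, with \<open>w\<close> built from the interpolated matrix. The
      multiplier \<open>k\<close> is therefore the same for \<open>i = 1\<close> and
      \<open>i = 2\<close>.\<close>
    define w where "w = A t *\<^sub>v u"
    define k where "k = G\<^sup>T *\<^sub>v w + V\<^sup>T *\<^sub>v u"
    have w: "w \<in> carrier_vec n" and k: "k \<in> carrier_vec n"
      using A u assms(5,6) by (auto simp: w_def k_def intro!: add_carrier_vec mult_mat_vec_carrier[of _ n n])
    have w_eq: "w = F *\<^sub>v u + (t * \<alpha> 1 + (1 - t) * \<alpha> 2) \<cdot>\<^sub>v (H *\<^sub>v u)"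
      using u assms(1,2) by (simp add: w_def A_def add_mult_distrib_mat_vec[of _ n n] smult_mat_mult_vec[of _ n n])
    have neg: "w \<bullet> (P i *\<^sub>v u) + k \<bullet> ((F + \<alpha> i \<cdot>\<^sub>m H) *\<^sub>v u - w) < 0" if i: "i \<in> {1, 2}" for i
    proof -
      let ?Ai = "F + \<alpha> i \<cdot>\<^sub>m H"
      have "w @\<^sub>v u \<noteq> 0\<^sub>v (n + n)"
      proof
        assume "w @\<^sub>v u = 0\<^sub>v (n + n)"
        also have "0\<^sub>v (n + n) = 0\<^sub>v n @\<^sub>v 0\<^sub>v n"
          by auto
        finally show False
          using w u append_vec_eq[of w n "0\<^sub>v n" u "0\<^sub>v n"] by simp
      qed
      moreover have "w @\<^sub>v u \<in> carrier_vec (n + n)"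
        using w u by simp
      moreover have "negative_definite (four_block_mat (- G - G\<^sup>T) (P i - V\<^sup>T + G * ?Ai)
          (P i - V + ?Ai\<^sup>T * G\<^sup>T) (V * ?Ai + ?Ai\<^sup>T * V\<^sup>T))" (is "negative_definite ?M")
        using assms(8) i by blast
      moreover have "dim_row ?M = n + n"
        using assms(1,2,5) by simp
      ultimately have "(w @\<^sub>v u) \<bullet> (?M *\<^sub>v (w @\<^sub>v u)) < 0"
        unfolding negative_definite_def by metis
      then show ?thesis
        using lmi_quadratic_form[OF _ assms(5,6) P[OF i] u(1) w, of ?Ai] assms(1,2)
        by (simp add: k_def)
    qed
    have A_eq: "k \<bullet> ((F + \<alpha> i \<cdot>\<^sub>m H) *\<^sub>v u - w) = k \<bullet> (F *\<^sub>v u) + \<alpha> i * (k \<bullet> (H *\<^sub>v u)) - k \<bullet> w" for i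
      using k w u assms(1,2)
      by (simp add: add_mult_distrib_mat_vec[of _ n n] smult_mat_mult_vec[of _ n n]
          scalar_prod_minus_distrib[of _ n] scalar_prod_add_distrib[of _ n])
    have "w \<bullet> (R t *\<^sub>v u) = t * (w \<bullet> (P 1 *\<^sub>v u)) + (1 - t) * (w \<bullet> (P 2 *\<^sub>v u))"
      using w u P(1)[of 1] P(1)[of 2]
      by (simp add: R_def add_mult_distrib_mat_vec[of _ n n] smult_mat_mult_vec[of _ n n]
          scalar_prod_add_distrib[of _ n])
    moreover have "k \<bullet> w = k \<bullet> (F *\<^sub>v u) + (t * \<alpha> 1 + (1 - t) * \<alpha> 2) * (k \<bullet> (H *\<^sub>v u))"
      unfolding w_eq using k u assms(1,2)
      by (simp add: scalar_prod_add_distrib[of _ n])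
    \<comment> \<open>With weights \<open>t\<close> and \<open>1 - t\<close> the endpoint residuals
      average to \<open>A t *\<^sub>v u - w\<close>, which is zero, so the terms with
      \<open>k\<close> cancel.\<close>
    ultimately have "w \<bullet> (R t *\<^sub>v u) =
        t * (w \<bullet> (P 1 *\<^sub>v u) + k \<bullet> ((F + \<alpha> 1 \<cdot>\<^sub>m H) *\<^sub>v u - w)) +
        (1 - t) * (w \<bullet> (P 2 *\<^sub>v u) + k \<bullet> ((F + \<alpha> 2 \<cdot>\<^sub>m H) *\<^sub>v u - w))"
      unfolding A_eq by (simp add: algebra_simps)
    also have "\<dots> < 0"
      using neg[of 1] neg[of 2] t
      \<comment> \<open>For \<open>t = 0\<close> only the second summand remains, with weight 1.
        Otherwise the first is strictly negative and the second nonpositive.\<close>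
      by (cases "t = 0") (simp_all add: add_neg_nonpos mult_pos_neg mult_nonneg_nonpos)
    finally show ?thesis
      by (simp add: w_def)
  qed
  have imag: "Re z \<noteq> 0" if "t \<in> {0..1}" "eigenvalue (map_mat complex_of_real (A t)) z" for t z
    using lyapunov_eigenvalue_not_imaginary[OF A R RT lyap] that by blast
  \<comment> \<open>\<open>A 1\<close> is the endpoint with parameter \<open>\<alpha> 1\<close>, so
    stability at \<open>\<mu>\<close> would spread along the segment to a matrix assumed
    unstable.\<close>
  have "stable_mat (A 1)" if "stable_mat (A \<mu>)"
  proof (rule stable_mat_connected[of "{0..1}" A n \<mu>])
    fix i j assume ij: "i < n" "j < n"
    have "continuous_on {0..1} (\<lambda>t. F $$ (i, j) + (t * \<alpha> 1 + (1 - t) * \<alpha> 2) * H $$ (i, j))"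
      by (intro continuous_intros)
    then show "continuous_on {0..1} (\<lambda>t. A t $$ (i, j))"
      using ij assms(1,2) by (simp add: A_def)
  qed (use A imag \<mu> that in auto)
  then show "unstable_mat (F + (\<mu> * \<alpha> 1 + (1 - \<mu>) * \<alpha> 2) \<cdot>\<^sub>m H)"
    using assms(3) by (auto simp: unstable_mat_def A_def)
qed

end
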